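(* Let $V$ and $W$ be two formal binary operation symbols, let $J_1^3,\dots,J_{40}^3$ be the $S_3^{VW}=40$ distinct iterates of order $3$ of $V$ and $W$, and let $T_3$ be their tableau of order $3$. For $1\le i,j\le 40$ let $\delta(J_i^3,J_j^3)=1$ if the identity $J_i^3=J_j^3$ is (formally) reducible, and $\delta(J_i^3,J_j^3)=0$ otherwise, and let $M(J_i^3)$ be the multiplicity of $J_i^3$ in $T_3$. Then for every $i\in\{1,\dots,40\}$ $$\sum_{j=1}^{40}\delta(J_i^3,J_j^3)=\sum_{\nu=1}^{M(J_i^3)}(-1)^{\nu-1}\binom{M(J_i^3)}{\nu}S^{VW}_{3-\nu}.$$ Explicitly, exactly $8$ of the iterates have multiplicity $2$, and for each of them the left-hand sum equals $14$; the other $32$ iterates have multiplicity $1$, and for each of them the left-hand sum equals $8$. Consequently the number of reducible $3$-identities is $$I_3^{VW}=\sum_{i=1}^{40}\sum_{j=1}^{40}\delta(J_i^3,J_j^3)=32\cdot 8+8\cdot 14=368.$$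
   Context: Iterates: for formal binary operation symbols $V,W$ and a single placeholder symbol $x$ for variable places, the iterates are the words in prefix (Polish) notation defined recursively as follows: $x$ is the only iterate of order $0$; an iterate of order $n+1$ is a word $UAB$ with $U\in\{V,W\}$, where $A$ and $B$ are iterates whose orders sum to $n$. Thus the order of an iterate is the total number of occurrences of $V$ and $W$ in it, and an iterate of order $n$ has $n+1$ variable places (occurrences of $x$), which are numbered $1,\dots,n+1$ from left to right. The number of iterates of order $n$ is denoted $S_n^{VW}$; one has $S_n^{VW}=2^nS_n$ with $S_n=\frac{1}{n+1}\binom{2n}{n}$, so $S_0^{VW}=1$, $S_1^{VW}=2$, $S_2^{VW}=8$, $S_3^{VW}=40$. Tableau $T_n$ ($n\ge 1$): an array with $2n$ lines, indexed by pairs $(k,U)$ with $k\in\{1,\dots,n\}$ and $U\in\{V,W\}$, and $S_{n-1}^{VW}$ columns, indexed by the iterates $J$ of order $n-1$. The entry in line $(k,U)$ and column $J$ is the iterate of order $n$ obtained from $J$ by replacing its $k$-th variable place $x$ with the word $Uxx$. For example, in $T_3$ the column of $VVxxx$ consists of $VVVxxxx$, $VVWxxxx$, $VVxVxxx$, $VVxWxxx$, $VVxxVxx$, $VVxxWxx$. Thus $T_3$ has $6$ lines and $8$ columns. Multiplicity: the multiplicity $M(J)$ of an iterate $J$ of order $n$ is the number of entries of the tableau $T_n$ equal to $J$. Reducibility: for iterates $J_i^n,J_j^n$ of order $n$ (possibly $i=j$), the $n$-identity $J_i^n=J_j^n$ is called (formally) reducible if there is at least one line of the tableau $T_n$ in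 which both $J_i^n$ and $J_j^n$ occur; otherwise it is called irreducible. Identities are counted as ordered pairs $(i,j)$. The matrix $\|\delta(J_i^3,J_j^3)\|$ is called the incidence matrix of $T_3$. *)

theory Defs
  imports Complex_Main
begin

datatype opsym = V | W

datatype sym = Op opsym | Place

type_synonym word = "sym list"

inductive is_iterate :: "nat \<Rightarrow> word \<Rightarrow> bool" where
  place: "is_iterate 0 [Place]"
| comp: "is_iterate a A \<Longrightarrow> is_iterate b B \<Longrightarrow> a + b = n \<Longrightarrow> is_iterate (Suc n) (Op U # A @ B)"

definition iterates :: "nat \<Rightarrow> word set" where
  "iterates n = {J. is_iterate n J}"

definition S_VW :: "nat \<Rightarrow> nat" where
  "S_VW n = card (iterates n)"

text \<open>Variable places are numbered from 1; a word is left unchanged if it has no place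
  with number \<open>k\<close> (in particular if \<open>k = 0\<close>).\<close>

fun replace_place :: "nat \<Rightarrow> word \<Rightarrow> word \<Rightarrow> word" where
  "replace_place k r [] = []"
| "replace_place k r (Op U # w) = Op U # replace_place k r w"
| "replace_place k r (Place # w) = (if k = 1 then r @ w else Place # replace_place (k - 1) r w)"

definition tableau_lines :: "nat \<Rightarrow> (nat \<times> opsym) set" where
  "tableau_lines n = {1..n} \<times> {V, W}"

definition tableau_columns :: "nat \<Rightarrow> word set" where
  "tableau_columns n = iterates (n - 1)"

text \<open>The entry does not depend on \<open>n\<close>: the tableau of order \<open>n\<close> is this array restricted to
  \<open>tableau_lines n\<close> and \<open>tableau_columns n\<close>, for \<open>n \<ge> 1\<close>.\<close>

definition tableau_entry :: "nat \<times> opsym \<Rightarrow> word \<Rightarrow> word" where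
  "tableau_entry l J = (case l of (k, U) \<Rightarrow> replace_place k [Op U, Place, Place] J)"

definition occurs_in_line :: "nat \<Rightarrow> nat \<times> opsym \<Rightarrow> word \<Rightarrow> bool" where
  "occurs_in_line n l J \<longleftrightarrow> (\<exists>C \<in> tableau_columns n. tableau_entry l C = J)"

text \<open>Multiplicity counts positions (line, column) of the array, not values.\<close>

definition tableau_mult :: "nat \<Rightarrow> word \<Rightarrow> nat" where
  "tableau_mult n J =
     card {(l, C). l \<in> tableau_lines n \<and> C \<in> tableau_columns n \<and> tableau_entry l C = J}"

definition reducible :: "nat \<Rightarrow> word \<Rightarrow> word \<Rightarrow> bool" where
  "reducible n J J' \<longleftrightarrow> (\<exists>l \<in> tableau_lines n. occurs_in_line n l J \<and> occurs_in_line n l J')"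

definition incidence :: "nat \<Rightarrow> word \<Rightarrow> word \<Rightarrow> int" where
  "incidence n J J' = (if reducible n J J' then 1 else 0)"

definition I_VW :: "nat \<Rightarrow> nat" where
  "I_VW n = card {(J, J'). J \<in> iterates n \<and> J' \<in> iterates n \<and> reducible n J J'}"

end

theory Submission
  imports Defs
begin

text \<open>
  An iterate is a full binary tree whose inner nodes carry \<open>V\<close> or \<open>W\<close>.  A word \<open>J\<close> occurs in line
  \<open>(k, U)\<close> of its tableau iff \<open>J\<close> has a cherry \<open>Uxx\<close>, a node with two leaves as children, occupying
  the places \<open>k\<close> and \<open>k + 1\<close>; contracting the cherry gives the column.  Hence \<open>M(J)\<close> is the number
  of cherries of \<open>J\<close>, and the row sum of the incidence matrix at \<open>J\<close> is the size of the union of the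
  lines belonging to these cherries (lemmas \<open>sum_incidence\<close> and \<open>reducible_row\<close>).

  In order 3, a tree has one cherry or two.  With one cherry the union is a single line, which has
  as many entries as there are columns, namely \<open>S\<^sub>2 = 8\<close>.  Two cherries occur only in the words
  with a root above two inner nodes, \<open>2\<^sup>3 = 8\<close> of them; the two lines then share the trees with both
  cherries, which contract to the \<open>S\<^sub>1 = 2\<close> trees of order 1, and inclusion-exclusion gives
  \<open>2 \<cdot> 8 - 2 = 14\<close>.  The alternating sum of the theorem is this inclusion-exclusion: it reads
  \<open>S\<^sub>2\<close> for \<open>M(J) = 1\<close> and \<open>2 S\<^sub>2 - S\<^sub>1\<close> for \<open>M(J) = 2\<close>.

  The words of order 3 are treated by enumeration: the sets of iterates are turned into lists
  without repetition (lemmas \<open>set_iterate_list\<close> and \<open>distinct_iterate_list\<close>), on which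
  multiplicities and unions of lines are evaluated by rewriting (lemma \<open>order_3_census\<close>).
\<close>

section \<open>Listing the iterates\<close>

fun iterate_list :: "nat \<Rightarrow> word list" where
  "iterate_list 0 = [[Place]]"
| "iterate_list (Suc n) = concat (map (\<lambda>a. concat (map (\<lambda>A. concat (map (\<lambda>B.
     [Op V # A @ B, Op W # A @ B]) (iterate_list (n - a)))) (iterate_list a))) [0..<Suc n])"

lemma is_iterate_0_iff: "is_iterate 0 J \<longleftrightarrow> J = [Place]"
  by (auto elim: is_iterate.cases intro: is_iterate.place)

lemma is_iterate_Suc_iff:
  "is_iterate (Suc n) J \<longleftrightarrow>
     (\<exists>U A B a. a \<le> n \<and> is_iterate a A \<and> is_iterate (n - a) B \<and> J = Op U # A @ B)"
proof
  assume "is_iterate (Suc n) J"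
  then show "\<exists>U A B a. a \<le> n \<and> is_iterate a A \<and> is_iterate (n - a) B \<and> J = Op U # A @ B"
  proof cases
    case (comp a A b B U)
    then have "a \<le> n \<and> is_iterate a A \<and> is_iterate (n - a) B \<and> J = Op U # A @ B"
      by auto
    then show ?thesis by blast
  qed
qed (auto intro: is_iterate.comp)

lemma set_iterate_list: "set (iterate_list n) = iterates n"
proof (induction n rule: less_induct)
  case (less n)
  show ?case
  proof (cases n)
    case 0
    then show ?thesis by (simp add: iterates_def is_iterate_0_iff)
  next
    case (Suc m)
    have IH: "J \<in> set (iterate_list a) \<longleftrightarrow> is_iterate a J" if "a \<le> m" for a J
      using less.IH[of a] that Suc by (simp add: iterates_def)
    have op: "(\<exists>U. P U) \<longleftrightarrow> P V \<or> P W" for P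
      by (metis opsym.exhaust)
    have "J \<in> set (iterate_list n) \<longleftrightarrow> is_iterate n J" for J
    proof -
      have "J \<in> set (iterate_list n) \<longleftrightarrow>
          (\<exists>a\<le>m. \<exists>A \<in> set (iterate_list a). \<exists>B \<in> set (iterate_list (m - a)).
             \<exists>U. J = Op U # A @ B)"
        unfolding Suc op
        by (simp add: Bex_def less_Suc_eq_le atLeast0LessThan lessThan_Suc_atMost del: upt_Suc)
      also have "\<dots> \<longleftrightarrow> (\<exists>a\<le>m. \<exists>A B U. is_iterate a A \<and> is_iterate (m - a) B \<and> J = Op U # A @ B)"
        by (simp add: IH Bex_def cong: conj_cong)
      also have "\<dots> \<longleftrightarrow> is_iterate n J"
        unfolding Suc is_iterate_Suc_iff by blast
      finally show ?thesis .
    qed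
    then show ?thesis by (auto simp: iterates_def)
  qed
qed

lemma finite_iterates: "finite (iterates n)"
  by (metis List.finite_set set_iterate_list)

section \<open>Replacing a place in an iterate\<close>

lemma replace_place_append:
  "replace_place k r (A @ B) =
     (if k \<le> count_list A Place then replace_place k r A @ B
      else A @ replace_place (k - count_list A Place) r B)" if "k \<ge> 1"
  using that
proof (induction k r A rule: replace_place.induct)
  case (3 k r w)
  then show ?case by (cases k) auto
qed auto

lemma count_places: "is_iterate n J \<Longrightarrow> count_list J Place = Suc n"
  by (induction rule: is_iterate.induct) auto

text \<open>The replaced place lies in one of the two arguments of the leading symbol, whose order it
  raises by 1.\<close>

lemma is_iterate_replace_place:
  "is_iterate n J \<Longrightarrow> k \<in> {1..Suc n} \<Longrightarrow> is_iterate (Suc n) (replace_place k [Op U, Place, Place] J)"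
proof (induction arbitrary: k rule: is_iterate.induct)
  case place
  have "is_iterate (Suc 0) (Op U # [Place] @ [Place])"
    by (rule is_iterate.comp[OF is_iterate.place is_iterate.place]) simp
  with place show ?case by simp
next
  case (comp a A b B n U')
  show ?case
  proof (cases "k \<le> Suc a")
    case True
    then have "is_iterate (Suc a) (replace_place k [Op U, Place, Place] A)"
      using comp by auto
    then have "is_iterate (Suc (Suc n)) (Op U' # replace_place k [Op U, Place, Place] A @ B)"
      using comp.hyps by (auto intro: is_iterate.comp)
    then show ?thesis
      using True comp by (simp add: replace_place_append count_places)
  next
    case False
    then have "k - Suc a \<in> {1..Suc b}"
      using comp by auto
    then have "is_iterate (Suc b) (replace_place (k - Suc a) [Op U, Place, Place] B)"
      by (rule comp.IH)
    then have "is_iterate (Suc (Suc n)) (Op U' # A @ replace_place (k - Suc a) [Op U, Place, Place] B)"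
      using comp.hyps by (auto intro: is_iterate.comp)
    then show ?thesis
      using False comp by (simp add: replace_place_append count_places)
  qed
qed

lemma tableau_entry_iterate:
  assumes "l \<in> tableau_lines n" and "C \<in> tableau_columns n"
  shows "tableau_entry l C \<in> iterates n"
proof -
  obtain k U where "l = (k, U)" "k \<in> {1..n}"
    using assms(1) by (auto simp: tableau_lines_def)
  then show ?thesis
    using assms(2) is_iterate_replace_place[of "n - 1" C k U]
    by (auto simp: tableau_entry_def tableau_columns_def iterates_def)
qed

section \<open>Rows of the incidence matrix\<close>

text \<open>Because all tableau entries are iterates of order \<open>n\<close>, the row of \<open>J\<close> is a union of whole
  lines, which makes it computable from the tableau alone.\<close>

lemma reducible_row:
  "{J' \<in> iterates n. reducible n J J'} =
     (\<Union>l \<in> {l \<in> tableau_lines n. J \<in> tableau_entry l ` tableau_columns n}.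
        tableau_entry l ` tableau_columns n)"
  by (fastforce simp: reducible_def occurs_in_line_def intro: tableau_entry_iterate)

lemma sum_incidence:
  assumes "bij_betw J {1..m::nat} (iterates n)"
  shows "(\<Sum>j = 1..m. incidence n I (J j)) = int (card {J' \<in> iterates n. reducible n I J'})"
proof -
  have "(\<Sum>j = 1..m. incidence n I (J j)) = (\<Sum>J' \<in> iterates n. incidence n I J')"
    by (rule sum.reindex_bij_betw[OF assms])
  also have "\<dots> = int (card {J' \<in> iterates n. reducible n I J'})"
    by (simp add: incidence_def finite_iterates sum.If_cases Int_def conj_commute)
  finally show ?thesis .
qed

lemma I_VW_eq_sum: "I_VW n = (\<Sum>I \<in> iterates n. card {J' \<in> iterates n. reducible n I J'})"
proof -
  have "{(I, J'). I \<in> iterates n \<and> J' \<in> iterates n \<and> reducible n I J'} =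
      (SIGMA I:iterates n. {J' \<in> iterates n. reducible n I J'})"
    by auto
  then show ?thesis
    by (simp add: I_VW_def finite_iterates)
qed

section \<open>The tableau of order 3\<close>

definition line_list :: "nat \<Rightarrow> (nat \<times> opsym) list" where
  "line_list n = List.product [1..<Suc n] [V, W]"

definition tableau_list :: "nat \<Rightarrow> word list list" where
  "tableau_list n = map (\<lambda>l. map (tableau_entry l) (iterate_list (n - 1))) (line_list n)"

lemma set_line_list: "set (line_list n) = tableau_lines n"
  by (auto simp: line_list_def tableau_lines_def)

lemma card_reducible_row:
  "card {J' \<in> iterates n. reducible n J J'} =
     length (remdups (concat (filter (\<lambda>L. J \<in> set L) (tableau_list n))))"
proof -
  have "{J' \<in> iterates n. reducible n J J'} =
      set (concat (filter (\<lambda>L. J \<in> set L) (tableau_list n)))"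
    unfolding reducible_row
    by (auto simp: tableau_list_def set_line_list set_iterate_list tableau_columns_def)
  then show ?thesis
    by (simp only: length_remdups_card_conv)
qed

text \<open>A multiplicity counts positions of the array, and a column listed twice would contribute its
  positions twice; this is why the list of columns has to be distinct.\<close>

lemma tableau_mult_eq_count:
  assumes "distinct (iterate_list (n - 1))"
  shows "tableau_mult n J = count_list (concat (tableau_list n)) J"
proof -
  let ?ps = "List.product (line_list n) (iterate_list (n - 1))"
  let ?f = "\<lambda>(l, C). tableau_entry l C"
  have tab: "concat (tableau_list n) = map ?f ?ps"
    by (simp add: tableau_list_def product_concat_map map_concat comp_def)
  have "distinct ?ps"
    using assms by (auto simp: line_list_def intro!: distinct_product)
  moreover have "{(l, C). l \<in> tableau_lines n \<and> C \<in> tableau_columns n \<and> tableau_entry l C = J} =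
      set (filter (\<lambda>p. ?f p = J) ?ps)"
    by (auto simp: set_line_list set_iterate_list tableau_columns_def)
  ultimately have "tableau_mult n J = length (filter (\<lambda>p. ?f p = J) ?ps)"
    by (simp only: tableau_mult_def distinct_card distinct_filter)
  also have "\<dots> = count_list (map ?f ?ps) J"
    by (simp add: count_list_eq_length_filter filter_map comp_def eq_commute)
  finally show ?thesis
    by (simp only: tab)
qed

lemma distinct_iterate_list:
  "distinct (iterate_list 1)" "distinct (iterate_list 2)" "distinct (iterate_list 3)"
  by code_simp+

lemma length_iterate_list:
  "length (iterate_list 1) = 2" "length (iterate_list 2) = 8" "length (iterate_list 3) = 40"
  by code_simp+

lemma S_VW_eq_length: "distinct (iterate_list n) \<Longrightarrow> S_VW n = length (iterate_list n)"
  by (simp add: S_VW_def distinct_card flip: set_iterate_list)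

lemma S_VW_values: "S_VW 1 = 2" "S_VW 2 = 8" "S_VW 3 = 40"
  by (simp_all only: S_VW_eq_length distinct_iterate_list length_iterate_list)

text \<open>Listing the pairs in enumeration order records which iterates have two cherries: those whose
  leading symbol has two arguments of order 1.  They form the middle block, \<open>a = 1\<close>, of the
  recursion for \<open>iterate_list\<close>.\<close>

lemma order_3_census:
  "map (\<lambda>J. (count_list (concat (tableau_list 3)) J,
             length (remdups (concat (filter (\<lambda>L. J \<in> set L) (tableau_list 3))))))
       (iterate_list 3) =
   replicate 16 (1, 8) @ replicate 8 (2, 14) @ replicate 16 (1, 8)"
  by code_simp

lemma order_3_map:
  "map (\<lambda>J. (tableau_mult 3 J, card {J' \<in> iterates 3. reducible 3 J J'})) (iterate_list 3) =
     replicate 16 (1, 8) @ replicate 8 (2, 14) @ replicate 16 (1, 8)"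
proof -
  have "tableau_mult 3 J = count_list (concat (tableau_list 3)) J" for J
    using distinct_iterate_list(2) by (simp add: tableau_mult_eq_count)
  then show ?thesis
    using order_3_census by (simp only: card_reducible_row)
qed

lemma order_3_cases:
  assumes "J \<in> iterates 3"
  shows "tableau_mult 3 J = 1 \<and> card {J' \<in> iterates 3. reducible 3 J J'} = 8 \<or>
    tableau_mult 3 J = 2 \<and> card {J' \<in> iterates 3. reducible 3 J J'} = 14"
proof -
  have "(tableau_mult 3 J, card {J' \<in> iterates 3. reducible 3 J J'}) \<in>
      set (replicate 16 (1, 8) @ replicate 8 (2, 14) @ replicate 16 (1, 8))"
    unfolding order_3_map[symmetric] using assms by (simp add: set_iterate_list)
  then show ?thesis by auto
qed

lemma order_3_card_mult:
  "card {J \<in> iterates 3. tableau_mult 3 J = m} =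
     length (filter (\<lambda>p. fst p = m)
       (replicate 16 (1, 8 :: nat) @ replicate 8 (2, 14) @ replicate 16 (1, 8)))"
proof -
  have "{J \<in> iterates 3. tableau_mult 3 J = m} =
      set (filter (\<lambda>J. tableau_mult 3 J = m) (iterate_list 3))"
    by (auto simp: set_iterate_list)
  then have "card {J \<in> iterates 3. tableau_mult 3 J = m} =
      length (filter (\<lambda>J. tableau_mult 3 J = m) (iterate_list 3))"
    by (simp only: distinct_card distinct_filter distinct_iterate_list)
  also have "\<dots> = length (filter (\<lambda>p. fst p = m)
      (map (\<lambda>J. (tableau_mult 3 J, card {J' \<in> iterates 3. reducible 3 J J'})) (iterate_list 3)))"
    by (simp add: filter_map comp_def)
  finally show ?thesis by (simp only: order_3_map)
qed

lemma I_VW_3: "I_VW 3 = 368"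
proof -
  have "I_VW 3 = sum_list (map snd
      (map (\<lambda>J. (tableau_mult 3 J, card {J' \<in> iterates 3. reducible 3 J J'})) (iterate_list 3)))"
    by (simp add: I_VW_eq_sum comp_def sum_list_distinct_conv_sum_set distinct_iterate_list
        set_iterate_list)
  then show ?thesis
    by (simp add: order_3_map sum_list_replicate)
qed

lemma card_index:
  assumes "bij_betw f I A"
  shows "card {i \<in> I. P (f i)} = card {x \<in> A. P x}"
proof (rule bij_betw_same_card)
  show "bij_betw f {i \<in> I. P (f i)} {x \<in> A. P x}"
    using assms by (auto simp: bij_betw_def inj_on_def)
qed

theorem mainTheorem1:
  shows "S_VW 3 = 40 \<and>
    (\<forall>J :: nat \<Rightarrow> word. bij_betw J {1..40} (iterates 3) \<longrightarrow>
      (\<forall>i \<in> {1..40}.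
         (\<Sum>j = 1..40. incidence 3 (J i) (J j)) =
         (\<Sum>\<nu> = 1..tableau_mult 3 (J i).
            (-1) ^ (\<nu> - 1) * int (tableau_mult 3 (J i) choose \<nu>) * int (S_VW (3 - \<nu>)))) \<and>
      card {i \<in> {1..40}. tableau_mult 3 (J i) = 2} = 8 \<and>
      (\<forall>i \<in> {1..40}. tableau_mult 3 (J i) = 2 \<longrightarrow>
         (\<Sum>j = 1..40. incidence 3 (J i) (J j)) = 14) \<and>
      card {i \<in> {1..40}. tableau_mult 3 (J i) = 1} = 32 \<and>
      (\<forall>i \<in> {1..40}. tableau_mult 3 (J i) = 1 \<longrightarrow>
         (\<Sum>j = 1..40. incidence 3 (J i) (J j)) = 8) \<and>
      int (I_VW 3) = (\<Sum>i = 1..40. \<Sum>j = 1..40. incidence 3 (J i) (J j)) \<and>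
      (\<Sum>i = 1..40. \<Sum>j = 1..40. incidence 3 (J i) (J j)) = 32 * 8 + 8 * 14 \<and>
      (32 * 8 + 8 * 14 :: int) = 368)"
proof -
  have rows:
    "(\<Sum>j = 1..40. incidence 3 (J i) (J j)) =
       (\<Sum>\<nu> = 1..tableau_mult 3 (J i).
          (-1) ^ (\<nu> - 1) * int (tableau_mult 3 (J i) choose \<nu>) * int (S_VW (3 - \<nu>)))"
    "tableau_mult 3 (J i) = 2 \<Longrightarrow> (\<Sum>j = 1..40. incidence 3 (J i) (J j)) = 14"
    "tableau_mult 3 (J i) = 1 \<Longrightarrow> (\<Sum>j = 1..40. incidence 3 (J i) (J j)) = 8"
    if bij: "bij_betw J {1..40} (iterates 3)" and i: "i \<in> {1..40}" for J :: "nat \<Rightarrow> word" and i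
  proof -
    note sum = sum_incidence[OF bij, of "J i"]
    have "J i \<in> iterates 3"
      using bij i by (auto simp: bij_betw_def)
    note cases = order_3_cases[OF this]
    have "{1..2::nat} = {1, 2}" by auto
    with cases show "(\<Sum>j = 1..40. incidence 3 (J i) (J j)) =
       (\<Sum>\<nu> = 1..tableau_mult 3 (J i).
          (-1) ^ (\<nu> - 1) * int (tableau_mult 3 (J i) choose \<nu>) * int (S_VW (3 - \<nu>)))"
      unfolding sum using S_VW_values by auto
    show "(\<Sum>j = 1..40. incidence 3 (J i) (J j)) = 14" if "tableau_mult 3 (J i) = 2"
      unfolding sum using that cases by simp
    show "(\<Sum>j = 1..40. incidence 3 (J i) (J j)) = 8" if "tableau_mult 3 (J i) = 1"
      unfolding sum using that cases by simp
  qed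
  have counts:
    "card {i \<in> {1..40}. tableau_mult 3 (J i) = 2} = 8"
    "card {i \<in> {1..40}. tableau_mult 3 (J i) = 1} = 32"
    if "bij_betw J {1..40} (iterates 3)" for J :: "nat \<Rightarrow> word"
    using card_index[OF that, of "\<lambda>I. tableau_mult 3 I = 2"]
      card_index[OF that, of "\<lambda>I. tableau_mult 3 I = 1"]
    by (simp_all add: order_3_card_mult)
  have total: "(\<Sum>i = 1..40. \<Sum>j = 1..40. incidence 3 (J i) (J j)) = int (I_VW 3)"
    if bij: "bij_betw J {1..40} (iterates 3)" for J :: "nat \<Rightarrow> word"
  proof -
    have "(\<Sum>i = 1..40. \<Sum>j = 1..40. incidence 3 (J i) (J j)) =
        (\<Sum>i = 1..40. int (card {J' \<in> iterates 3. reducible 3 (J i) J'}))"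
      by (simp only: sum_incidence[OF bij])
    also have "\<dots> = (\<Sum>I \<in> iterates 3. int (card {J' \<in> iterates 3. reducible 3 I J'}))"
      by (rule sum.reindex_bij_betw[OF bij])
    finally show ?thesis by (simp add: I_VW_eq_sum)
  qed
  show ?thesis
    using rows counts total I_VW_3 S_VW_values(3) by simp
qed

end
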